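(* Let $W\in\mathscr{X}\setminus\{\mathcal{N}\}$, let $\mathcal{X}\subseteq\mathscr{X}$ with $\mathcal{N}\in\mathcal{X}$, and let $\pi^+_W\colon\mathcal{X}\to\mathscr{X}$ be the hypergraph addition partial transformation, i.e. for $X\in\mathcal{X}$, $\pi^+_W(X)=X\oplus W$ if $V(W)\cap V(X)=\emptyset$ and $\pi^+_W(X)=X$ if $V(W)\cap V(X)\neq\emptyset$. Define $\mathcal{S}^+:=\{\mathcal{N}\}$, and for $X\in\mathcal{X}$ define $\mathcal{D}^+_X:=\{\mathcal{N}\}$. Then $\mathcal{T}^+_W:=(\mathcal{X},\pi^+_W,\mathcal{S}^+)$ is a hypergraph transformation on $\mathscr{X}$ with $\mathcal{S}^+$-maximal subsets $\{\mathcal{D}^+_X\}_{X\in\mathcal{X}}$.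
   Context: Hypergraphs. Fix a nonempty set $L_V$ of vertices (vertices are identified with their labels) and a set $\mathbb{E}$ of labelled hyperedges: each $e\in\mathbb{E}$ has an underlying nonempty finite subset of $L_V$, also written $e$; every nonempty finite subset of $L_V$ (of size $\ge 2$ if loops are disallowed) underlies at least one and only finitely many elements of $\mathbb{E}$, so multiple hyperedges are allowed. Loops ($|e|=1$) are either allowed throughout or disallowed throughout. A hypergraph is a pair $X=(V(X),E(X))$ with $V(X)\subseteq L_V$ finite, $E(X)\subseteq\mathbb{E}$ finite, and $e\subseteq V(X)$ for all $e\in E(X)$. Let $\mathscr{X}$ be the set of all hypergraphs (the hypergraph family), and let $\mathcal{N}$ be the null hypergraph (no vertices). A hypergraph is connected if it is nonnull and any two vertices are joined by a path; $\mathcal{C}(X)$ denotes the set of connected components of $X$ (maximal connected subhypergraphs), so $\mathcal{C}(\mathcal{N})=\emptyset$. $X,Y$ are (vertex) disjoint if $V(X)\cap V(Y)=\emptyset$, and component disjoint if $\mathcal{C}(X)\cap\mathcal{C}(Y)=\emptyset$. For pairwise disjoint hypergraphs, the direct sum $\bigoplus_i X_i$ has vertex set $\bigcup_i V(X_i)$ and hyperedge set $\bigcup_i E(X_i)$; the empty direct sum is $\mathcal{N}$. If $X=Y\oplus Z$ with $Y,Z$ disjoint, the direct difference is $X\ominus Z:=Y$ (it is defined exactly when $\mathcal{C}(Z)\subseteq\mathcal{C}(X)$). Component maximality. For $\mathcal{S}\subseteq\mathcal{X}\subseteq\mathscr{X}$, $\mathcal{S}$ is component maximal in $\mathcal{X}$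 if for each $X\in\mathcal{X}$ there is a subset $\mathcal{D}_X\subseteq\mathcal{S}$, called an $\mathcal{S}$-maximal subset, such that: (1) $\mathcal{D}_X$ is pairwise component disjoint; (2) if $\mathcal{N}\in\mathcal{S}$ then $\mathcal{N}\in\mathcal{D}_X$; (3) $\mathcal{C}(T)\subseteq\mathcal{C}(X)$ for all $T\in\mathcal{D}_X$; (4) if $S\in\mathcal{S}$ and $\mathcal{C}(S)\subseteq\mathcal{C}(X)$ then there is $T\in\mathcal{D}_X$ with $\mathcal{C}(S)\subseteq\mathcal{C}(T)$. (Such $\mathcal{D}_X$ is unique.) Hypergraph transformation. A partial transformation on $\mathscr{X}$ is a map $\pi\colon\mathcal{X}\to\mathscr{X}$ with $\mathcal{X}\subseteq\mathscr{X}$. A hypergraph transformation on $\mathscr{X}$ is a triple $(\mathcal{X},\pi,\mathcal{S})$ with $\pi\colon\mathcal{X}\to\mathscr{X}$ a partial transformation and $\mathcal{S}\subseteq\mathcal{X}$ (the distinguished hypergraphs) such that: (1) $\mathcal{C}(S)\cap\mathcal{C}(\pi(S))=\emptyset$ for all $S\in\mathcal{S}$, and if $\mathcal{N}\in\mathcal{S}$ then $\pi(\mathcal{N})\ne\mathcal{N}$ (nonredundancy); (2) $\mathcal{S}$ is component maximal in $\mathcal{X}$, with $\mathcal{S}$-maximal subsets $\{\mathcal{D}_X\}_{X\in\mathcal{X}}$; (3) for each $X\in\mathcal{X}$, with $\mathcal{S}_X:=\{S\in\mathcal{D}_X\mid V(\pi(S))\cap V(X\ominus S)=\emptyset\}$,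 the set $\pi(\mathcal{S}_X)$ consists of pairwise vertex-disjoint hypergraphs, $|\pi(\mathcal{S}_X)|=|\mathcal{S}_X|$, and $\pi(X)=\overline{X}\oplus\bigoplus_{S\in\mathcal{S}_X}\pi(S)$ where $\overline{X}:=X\ominus\bigoplus_{S\in\mathcal{S}_X}S$. *)

theory Defs
  imports Main "HOL-Library.FuncSet"
begin

datatype ('v, 'e) hypergraph = Hypergraph (verts: "'v set") (edges: "'e set")

definition null_hypergraph :: "('v, 'e) hypergraph" where
  "null_hypergraph = Hypergraph {} {}"

definition subhypergraph :: "('v, 'e) hypergraph \<Rightarrow> ('v, 'e) hypergraph \<Rightarrow> bool" where
  "subhypergraph Y X \<longleftrightarrow> verts Y \<subseteq> verts X \<and> edges Y \<subseteq> edges X"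

definition hg_disjoint :: "('v, 'e) hypergraph \<Rightarrow> ('v, 'e) hypergraph \<Rightarrow> bool" where
  "hg_disjoint X Y \<longleftrightarrow> verts X \<inter> verts Y = {}"

text \<open>The direct sums are total functions here; they carry their mathematical meaning only
  for (pairwise) disjoint summands. The sum over the empty index set is the null hypergraph.\<close>

definition direct_sum ::
    "('v, 'e) hypergraph \<Rightarrow> ('v, 'e) hypergraph \<Rightarrow> ('v, 'e) hypergraph" where
  "direct_sum X Y = Hypergraph (verts X \<union> verts Y) (edges X \<union> edges Y)"

definition big_direct_sum ::
    "('i \<Rightarrow> ('v, 'e) hypergraph) \<Rightarrow> 'i set \<Rightarrow> ('v, 'e) hypergraph" where
  "big_direct_sum F I = Hypergraph (\<Union>i\<in>I. verts (F i)) (\<Union>i\<in>I. edges (F i))"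

definition hg_addition ::
    "('v, 'e) hypergraph \<Rightarrow> ('v, 'e) hypergraph \<Rightarrow> ('v, 'e) hypergraph" where
  "hg_addition W X = (if verts W \<inter> verts X = {} then direct_sum X W else X)"

text \<open>\<open>LV\<close> is the set of vertices and \<open>EE\<close> the set of labelled hyperedges, \<open>und e\<close> being the
  underlying vertex set of \<open>e\<close>. The flag \<open>loops\<close> says whether loops are allowed
  throughout or disallowed throughout.\<close>

locale hypergraph_labels =
  fixes LV :: "'v set" and EE :: "'e set" and und :: "'e \<Rightarrow> 'v set" and loops :: bool
  assumes LV_nonempty: "LV \<noteq> {}"
    and und_subset: "\<And>e. e \<in> EE \<Longrightarrow> und e \<subseteq> LV"
    and und_finite: "\<And>e. e \<in> EE \<Longrightarrow> finite (und e)"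
    and und_nonempty: "\<And>e. e \<in> EE \<Longrightarrow> und e \<noteq> {}"
    and und_loops: "\<And>e. e \<in> EE \<Longrightarrow> loops \<or> card (und e) \<ge> 2"
    and edge_exists: "\<And>U. \<lbrakk>U \<subseteq> LV; finite U; U \<noteq> {}; loops \<or> card U \<ge> 2\<rbrakk>
          \<Longrightarrow> {e \<in> EE. und e = U} \<noteq> {}"
    and edge_finite: "\<And>U. \<lbrakk>U \<subseteq> LV; finite U; U \<noteq> {}; loops \<or> card U \<ge> 2\<rbrakk>
          \<Longrightarrow> finite {e \<in> EE. und e = U}"
begin

definition hypergraphs :: "('v, 'e) hypergraph set" where
  "hypergraphs = {X. verts X \<subseteq> LV \<and> finite (verts X) \<and> edges X \<subseteq> EE \<and> finite (edges X) \<and>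
                     (\<forall>e\<in>edges X. und e \<subseteq> verts X)}"

text \<open>A path has distinct vertices \<open>vs = [v\<^sub>0, \<dots>, v\<^sub>n]\<close> and distinct hyperedges
  \<open>es = [e\<^sub>1, \<dots>, e\<^sub>n]\<close> with both \<open>v\<^sub>i\<close> and \<open>v\<^sub>i\<^sub>+\<^sub>1\<close> in \<open>e\<^sub>i\<^sub>+\<^sub>1\<close>; the case \<open>n = 0\<close> is
  the trivial path joining a vertex to itself.\<close>

definition hg_path :: "('v, 'e) hypergraph \<Rightarrow> 'v list \<Rightarrow> 'e list \<Rightarrow> bool" where
  "hg_path X vs es \<longleftrightarrow>
     length vs = Suc (length es) \<and> distinct vs \<and> distinct es \<and>
     set vs \<subseteq> verts X \<and> set es \<subseteq> edges X \<and>
     (\<forall>i < length es. vs ! i \<in> und (es ! i) \<and> vs ! Suc i \<in> und (es ! i))"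

definition hg_connected :: "('v, 'e) hypergraph \<Rightarrow> bool" where
  "hg_connected X \<longleftrightarrow> X \<noteq> null_hypergraph \<and>
     (\<forall>u\<in>verts X. \<forall>v\<in>verts X. \<exists>vs es. hg_path X vs es \<and> hd vs = u \<and> last vs = v)"

definition components :: "('v, 'e) hypergraph \<Rightarrow> ('v, 'e) hypergraph set" where
  "components X = {Y \<in> hypergraphs. subhypergraph Y X \<and> hg_connected Y \<and>
     (\<forall>Z\<in>hypergraphs. subhypergraph Z X \<and> hg_connected Z \<and> subhypergraph Y Z \<longrightarrow> Z = Y)}"

definition component_disjoint :: "('v, 'e) hypergraph \<Rightarrow> ('v, 'e) hypergraph \<Rightarrow> bool" where
  "component_disjoint X Y \<longleftrightarrow> components X \<inter> components Y = {}"

text \<open>Unspecified unless \<open>X\<close> is a direct sum with summand \<open>Z\<close>. If it is, then the other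
  summand \<open>Y\<close> is unique because hyperedges are nonempty.\<close>

definition direct_diff ::
    "('v, 'e) hypergraph \<Rightarrow> ('v, 'e) hypergraph \<Rightarrow> ('v, 'e) hypergraph" where
  "direct_diff X Z = (THE Y. Y \<in> hypergraphs \<and> hg_disjoint Y Z \<and> X = direct_sum Y Z)"

definition maximal_subset ::
    "('v, 'e) hypergraph set \<Rightarrow> ('v, 'e) hypergraph \<Rightarrow> ('v, 'e) hypergraph set \<Rightarrow> bool" where
  "maximal_subset \<S> X D \<longleftrightarrow>
     D \<subseteq> \<S> \<and>
     pairwise component_disjoint D \<and>
     (null_hypergraph \<in> \<S> \<longrightarrow> null_hypergraph \<in> D) \<and>
     (\<forall>T\<in>D. components T \<subseteq> components X) \<and>
     (\<forall>S\<in>\<S>. components S \<subseteq> components X \<longrightarrow> (\<exists>T\<in>D. components S \<subseteq> components T))"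

definition component_maximal_with ::
    "('v, 'e) hypergraph set \<Rightarrow> ('v, 'e) hypergraph set
      \<Rightarrow> (('v, 'e) hypergraph \<Rightarrow> ('v, 'e) hypergraph set) \<Rightarrow> bool" where
  "component_maximal_with \<S> \<X> D \<longleftrightarrow>
     \<S> \<subseteq> \<X> \<and> \<X> \<subseteq> hypergraphs \<and> (\<forall>X\<in>\<X>. maximal_subset \<S> X (D X))"

text \<open>Only the values of \<open>\<pi>\<close> on \<open>\<X>\<close> matter in what follows: a map with domain \<open>\<X>\<close> is
  represented by any total function extending it. Likewise for the families \<open>D\<close>.\<close>

definition partial_transformation ::
    "('v, 'e) hypergraph set \<Rightarrow> (('v, 'e) hypergraph \<Rightarrow> ('v, 'e) hypergraph) \<Rightarrow> bool" where
  "partial_transformation \<X> \<pi> \<longleftrightarrow> \<X> \<subseteq> hypergraphs \<and> \<pi> \<in> \<X> \<rightarrow> hypergraphs"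

definition active_subset ::
    "(('v, 'e) hypergraph \<Rightarrow> ('v, 'e) hypergraph)
      \<Rightarrow> (('v, 'e) hypergraph \<Rightarrow> ('v, 'e) hypergraph set)
      \<Rightarrow> ('v, 'e) hypergraph \<Rightarrow> ('v, 'e) hypergraph set" where
  "active_subset \<pi> D X = {S \<in> D X. verts (\<pi> S) \<inter> verts (direct_diff X S) = {}}"

text \<open>In the last clause \<open>card\<close> is harmless: \<open>D X\<close> is finite, since a hypergraph is
  determined by its components and \<open>X\<close> has finitely many of them.\<close>

definition hypergraph_transformation_with ::
    "('v, 'e) hypergraph set \<Rightarrow> (('v, 'e) hypergraph \<Rightarrow> ('v, 'e) hypergraph)
      \<Rightarrow> ('v, 'e) hypergraph set
      \<Rightarrow> (('v, 'e) hypergraph \<Rightarrow> ('v, 'e) hypergraph set) \<Rightarrow> bool" where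
  "hypergraph_transformation_with \<X> \<pi> \<S> D \<longleftrightarrow>
     partial_transformation \<X> \<pi> \<and>
     \<S> \<subseteq> \<X> \<and>
     (\<forall>S\<in>\<S>. components S \<inter> components (\<pi> S) = {}) \<and>
     (null_hypergraph \<in> \<S> \<longrightarrow> \<pi> null_hypergraph \<noteq> null_hypergraph) \<and>
     component_maximal_with \<S> \<X> D \<and>
     (\<forall>X\<in>\<X>.
        pairwise hg_disjoint (\<pi> ` active_subset \<pi> D X) \<and>
        card (\<pi> ` active_subset \<pi> D X) = card (active_subset \<pi> D X) \<and>
        \<pi> X = direct_sum (direct_diff X (big_direct_sum (\<lambda>S. S) (active_subset \<pi> D X)))
                         (big_direct_sum \<pi> (active_subset \<pi> D X)))"

definition hypergraph_transformation ::
    "('v, 'e) hypergraph set \<Rightarrow> (('v, 'e) hypergraph \<Rightarrow> ('v, 'e) hypergraph)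
      \<Rightarrow> ('v, 'e) hypergraph set \<Rightarrow> bool" where
  "hypergraph_transformation \<X> \<pi> \<S> \<longleftrightarrow> (\<exists>D. hypergraph_transformation_with \<X> \<pi> \<S> D)"

end

end

theory Submission
  imports Defs
begin

text \<open>The null hypergraph \<open>\<N>\<close> has no components, so the component conditions on
  \<open>\<S> = {\<N>}\<close> and on the maximal subsets \<open>{\<N>}\<close> hold trivially, and nonredundancy
  reduces to \<open>\<pi> \<N> = \<N> \<oplus> W = W \<noteq> \<N>\<close>. The content lies in the formula for \<open>\<pi> X\<close>. Since
  \<open>X \<ominus> \<N> = X\<close> and \<open>\<pi> \<N> = W\<close>, the condition
  for \<open>\<N>\<close> to be active at \<open>X\<close> is exactly the condition \<open>V(W) \<inter> V(X) = \<emptyset>\<close> under which \<open>\<pi>\<close> adds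
  \<open>W\<close>. In both cases the direct sum of the active hypergraphs is \<open>\<N>\<close>, so \<open>X\<close> itself is
  what remains unchanged; and the direct sum of their images is \<open>W\<close> or \<open>\<N>\<close>, according to
  whether \<open>W\<close> is to be added.\<close>

lemma verts_null_hypergraph [simp]: "verts null_hypergraph = {}"
  and edges_null_hypergraph [simp]: "edges null_hypergraph = {}"
  by (simp_all add: null_hypergraph_def)

lemma direct_sum_null_left [simp]: "direct_sum null_hypergraph X = X"
  and direct_sum_null_right [simp]: "direct_sum X null_hypergraph = X"
  by (simp_all add: direct_sum_def)

lemma big_direct_sum_empty [simp]: "big_direct_sum F {} = null_hypergraph"
  by (simp add: big_direct_sum_def null_hypergraph_def)

lemma big_direct_sum_singleton [simp]: "big_direct_sum F {i} = F i"
  by (simp add: big_direct_sum_def)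

lemma hg_addition_null [simp]: "hg_addition W null_hypergraph = W"
  by (simp add: hg_addition_def)

context hypergraph_labels
begin

text \<open>The only subhypergraph of the null hypergraph is itself, and it is not connected by
  convention.\<close>

lemma components_null_hypergraph [simp]: "components null_hypergraph = {}"
proof -
  have "Y = null_hypergraph" if "subhypergraph Y null_hypergraph" for Y :: "('v, 'e) hypergraph"
    using that by (cases Y) (simp add: subhypergraph_def null_hypergraph_def)
  then show ?thesis
    by (auto simp: components_def hg_connected_def)
qed

lemma direct_diff_null [simp]:
  assumes "X \<in> hypergraphs"
  shows "direct_diff X null_hypergraph = X"
  unfolding direct_diff_def
  using assms by (intro the_equality) (auto simp: hg_disjoint_def)

lemma hg_addition_in_hypergraphs:
  assumes "W \<in> hypergraphs" "X \<in> hypergraphs"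
  shows "hg_addition W X \<in> hypergraphs"
  using assms by (auto simp: hg_addition_def direct_sum_def hypergraphs_def)

lemma maximal_subset_null: "maximal_subset {null_hypergraph} X {null_hypergraph}"
  by (simp add: maximal_subset_def)

text \<open>This identifies the transformation's own test for activity with the case distinction
  that defines hypergraph addition.\<close>

lemma active_subset_hg_addition:
  assumes "X \<in> hypergraphs"
  shows "active_subset (hg_addition W) (\<lambda>X. {null_hypergraph}) X =
    (if verts W \<inter> verts X = {} then {null_hypergraph} else {})"
  using assms by (auto simp: active_subset_def)

lemma hypergraph_transformation_with_hg_addition:
  assumes W: "W \<in> hypergraphs" "W \<noteq> null_hypergraph"
    and \<X>: "\<X> \<subseteq> hypergraphs" "null_hypergraph \<in> \<X>"
  shows "hypergraph_transformation_with \<X> (hg_addition W) {null_hypergraph}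
    (\<lambda>X. {null_hypergraph})"
proof -
  have "partial_transformation \<X> (hg_addition W)"
    using W \<X> by (auto simp: partial_transformation_def intro: hg_addition_in_hypergraphs)
  moreover have "component_maximal_with {null_hypergraph} \<X> (\<lambda>X. {null_hypergraph})"
    using \<X> by (simp add: component_maximal_with_def maximal_subset_null)
  moreover have "pairwise hg_disjoint (hg_addition W ` A) \<and> card (hg_addition W ` A) = card A \<and>
      hg_addition W X = direct_sum (direct_diff X (big_direct_sum (\<lambda>S. S) A))
                                   (big_direct_sum (hg_addition W) A)"
    if "X \<in> \<X>" and A: "A = active_subset (hg_addition W) (\<lambda>X. {null_hypergraph}) X" for X A
  proof -
    have X: "X \<in> hypergraphs"
      using that \<X> by blast
    show ?thesis
    proof (cases "verts W \<inter> verts X = {}")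
      case True
      then have "A = {null_hypergraph}"
        using X by (simp add: A active_subset_hg_addition)
      moreover have "hg_addition W X = direct_sum X W"
        using True by (simp add: hg_addition_def)
      ultimately show ?thesis
        using X by simp
    next
      case False
      then have "A = {}"
        using X by (simp add: A active_subset_hg_addition)
      moreover have "hg_addition W X = X"
        using False by (simp add: hg_addition_def)
      ultimately show ?thesis
        using X by simp
    qed
  qed
  ultimately show ?thesis
    using W \<X> by (simp add: hypergraph_transformation_with_def)
qed

end

theorem proposition3p31:
  fixes LV :: "'v set" and EE :: "'e set" and und :: "'e \<Rightarrow> 'v set" and loops :: bool
    and W :: "('v, 'e) hypergraph" and \<X> :: "('v, 'e) hypergraph set"
  assumes "hypergraph_labels LV EE und loops"
    and "W \<in> hypergraph_labels.hypergraphs LV EE und - {null_hypergraph}"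
    and "\<X> \<subseteq> hypergraph_labels.hypergraphs LV EE und"
    and "null_hypergraph \<in> \<X>"
  shows "hypergraph_labels.hypergraph_transformation LV EE und \<X> (hg_addition W) {null_hypergraph}
    \<and> hypergraph_labels.hypergraph_transformation_with LV EE und
          \<X> (hg_addition W) {null_hypergraph} (\<lambda>X. {null_hypergraph})"
proof -
  interpret hypergraph_labels LV EE und loops
    by (fact assms(1))
  have "hypergraph_transformation_with \<X> (hg_addition W) {null_hypergraph}
    (\<lambda>X. {null_hypergraph})"
    using assms(2-4) by (intro hypergraph_transformation_with_hg_addition) auto
  then show ?thesis
    unfolding hypergraph_transformation_def by blast
qed

end
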